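(* Let $\lambda,m,n,h,k$ be positive integers with $h\le n$, $k\le m$, $nk=mh$ and $3=\frac{2nk}{\lambda}+1$. Then there exists a ${}^\lambda\mathrm{NH}(m,n;h,k)$ over $\mathbb{Z}_3$ (relative to the trivial subgroup).
   Context: An $m\times n$ partially filled (p.f.) array over a group $G$ (written additively) is an $m\times n$ matrix each of whose cells is empty or contains an element of $G$. For a subgroup $J$ of order $t$, a ${}^\lambda\mathrm{NH}_t(m,n;h,k)$ over $G$ relative to $J$ is an $m\times n$ p.f. array $A$ over $G$ such that: (a) each row contains exactly $h$ filled cells and each column exactly $k$ filled cells; (b) the multiset obtained by taking, for every filled cell with entry $x$, both $x$ and $-x$ (with multiplicity), is exactly the multiset containing each element of $G\setminus J$ exactly $\lambda$ times; (c) each row sum (left to right) and each column sum (top to bottom) is nonzero. When $t=1$ the subscript is omitted. *)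

theory Defs
  imports "Jordan_Normal_Form.Matrix" "HOL-Algebra.Elementary_Groups"
begin

text \<open>
  Cells are indexed from \<open>(0,0)\<close>; \<open>None\<close> is an empty cell. HOL-Algebra groups are written
  multiplicatively, so the sum, the zero and the negative of the additive notation are
  \<open>\<otimes>\<close>, \<open>\<one>\<close> and \<open>inv\<close>. Groups need not be commutative or finite.
\<close>

definition pf_array :: "('a, 'b) monoid_scheme \<Rightarrow> nat \<Rightarrow> nat \<Rightarrow> 'a option mat \<Rightarrow> bool" where
  "pf_array G m n A \<longleftrightarrow>
     A \<in> carrier_mat m n \<and> (\<forall>i<m. \<forall>j<n. set_option (A $$ (i, j)) \<subseteq> carrier G)"

definition filled_cells :: "'a option mat \<Rightarrow> (nat \<times> nat) set" where
  "filled_cells A = {(i, j). i < dim_row A \<and> j < dim_col A \<and> A $$ (i, j) \<noteq> None}"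

definition entries :: "'a option vec \<Rightarrow> 'a list" where
  "entries v = List.map_filter id (list_of_vec v)"

text \<open>The sum of the filled cells in increasing order of the index, which matters if \<open>G\<close> is not
  commutative.\<close>

definition ordered_sum :: "('a, 'b) monoid_scheme \<Rightarrow> 'a option vec \<Rightarrow> 'a" where
  "ordered_sum G v = foldl (\<otimes>\<^bsub>G\<^esub>) \<one>\<^bsub>G\<^esub> (entries v)"

text \<open>An entry \<open>x\<close> with \<open>inv x = x\<close> is counted twice.\<close>

definition signed_entries :: "('a, 'b) monoid_scheme \<Rightarrow> 'a option mat \<Rightarrow> 'a multiset" where
  "signed_entries G A =
     (\<Sum>(i, j)\<in>filled_cells A. {#the (A $$ (i, j)), inv\<^bsub>G\<^esub> (the (A $$ (i, j)))#})"

text \<open>\<open>relative_NH G J t lam m n h k A\<close>: \<open>A\<close> is a \<open>\<^sup>\<lambda>NH\<^sub>t(m,n;h,k)\<close> over \<open>G\<close> relative to \<open>J\<close>.\<close>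

definition relative_NH ::
  "('a, 'b) monoid_scheme \<Rightarrow> 'a set \<Rightarrow> nat \<Rightarrow> nat \<Rightarrow> nat \<Rightarrow> nat \<Rightarrow> nat \<Rightarrow> nat \<Rightarrow> 'a option mat \<Rightarrow> bool"
where
  "relative_NH G J t lam m n h k A \<longleftrightarrow>
     group G \<and> subgroup J G \<and> finite J \<and> card J = t \<and>
     pf_array G m n A \<and>
     (\<forall>i<m. card {j. (i, j) \<in> filled_cells A} = h) \<and>
     (\<forall>j<n. card {i. (i, j) \<in> filled_cells A} = k) \<and>
     (\<forall>x. count (signed_entries G A) x = (if x \<in> carrier G - J then lam else 0)) \<and>
     (\<forall>i<m. ordered_sum G (row A i) \<noteq> \<one>\<^bsub>G\<^esub>) \<and>
     (\<forall>j<n. ordered_sum G (col A j) \<noteq> \<one>\<^bsub>G\<^esub>)"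

abbreviation NH ::
  "('a, 'b) monoid_scheme \<Rightarrow> nat \<Rightarrow> nat \<Rightarrow> nat \<Rightarrow> nat \<Rightarrow> nat \<Rightarrow> 'a option mat \<Rightarrow> bool"
where
  "NH G \<equiv> relative_NH G {\<one>\<^bsub>G\<^esub>} 1"

end

theory Submission
  imports Defs
begin

text \<open>
  Here \<open>lam = n * k\<close>, and a filled cell with entry \<open>1\<close> or \<open>2\<close> contributes both \<open>1\<close> and \<open>2\<close> to the
  signed entries, so only the fill counts and the nonzero sums matter. With \<open>g = gcd h n\<close> one has
  \<open>n = d * g\<close>, \<open>h = e * g\<close>, \<open>m = d * q\<close>, \<open>k = e * q\<close> and \<open>e \<le> d\<close>. Fill \<open>e\<close> cyclic diagonals of a
  \<open>d \<times> d\<close> array of \<open>q \<times> g\<close> blocks, and put \<open>2\<close> instead of \<open>1\<close> in position \<open>(a, b)\<close> of the blocks on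
  \<open>w a b\<close> of the diagonals. A row with local index \<open>a\<close> then sums to \<open>e * g + (\<Sum>b. w a b)\<close>, a column
  with local index \<open>b\<close> to \<open>e * q + (\<Sum>a. w a b)\<close>. A matrix \<open>w\<close> supported on its first row and first
  column suffices to keep all of these nonzero modulo \<open>3\<close>.
\<close>

section \<open>Sums over blocks and cyclic diagonals\<close>

lemma sum_div_mod:
  fixes F :: "nat \<Rightarrow> nat \<Rightarrow> 'a::comm_monoid_add"
  shows "(\<Sum>j<d * g. F (j div g) (j mod g)) = (\<Sum>J<d. \<Sum>b<g. F J b)"
proof -
  have "(\<Sum>j<d * g. F (j div g) (j mod g))
      = (\<Sum>J<d. \<Sum>j\<in>{J * g..<J * g + g}. F (j div g) (j mod g))"
    by (simp add: sum.nat_group)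
  also have "\<dots> = (\<Sum>J<d. \<Sum>b<g. F J b)"
  proof (rule sum.cong[OF refl])
    fix J
    have "(\<Sum>j\<in>{J * g..<J * g + g}. F (j div g) (j mod g))
        = (\<Sum>b<g. F ((b + J * g) div g) ((b + J * g) mod g))"
      using sum.shift_bounds_nat_ivl[of "\<lambda>j. F (j div g) (j mod g)" 0 "J * g" g]
      by (simp add: atLeast0LessThan add.commute)
    also have "\<dots> = (\<Sum>b<g. F J b)"
      by (rule sum.cong) auto
    finally show "(\<Sum>j\<in>{J * g..<J * g + g}. F (j div g) (j mod g)) = (\<Sum>b<g. F J b)" .
  qed
  finally show ?thesis .
qed

lemma bij_betw_lessThan_if_inj:
  fixes f :: "nat \<Rightarrow> nat"
  assumes "inj_on f {..<d}" and "\<And>x. x < d \<Longrightarrow> f x < d"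
  shows "bij_betw f {..<d} {..<d}"
  using assms by (simp add: bij_betw_def endo_inj_surj image_subset_iff)

text \<open>Reduces injectivity in either argument to linear arithmetic; adding \<open>d\<close>
  first keeps the natural subtraction from truncating.\<close>

lemma cyclic_diff_eq:
  fixes d I J :: nat
  assumes "I < d" and "J < d"
  shows "(J + d - I) mod d = (if I \<le> J then J - I else J + d - I)"
proof (cases "I \<le> J")
  case True
  then have "J + d - I = (J - I) + d" by simp
  then show ?thesis using True assms by (simp only: mod_add_self2 mod_less less_imp_diff_less if_True)
qed (use assms in simp)

lemma bij_betw_cyclic_diff_left:
  fixes d I :: nat
  assumes "I < d"
  shows "bij_betw (\<lambda>J. (J + d - I) mod d) {..<d} {..<d}"
proof (rule bij_betw_lessThan_if_inj)
  show "inj_on (\<lambda>J. (J + d - I) mod d) {..<d}"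
    using assms by (auto simp: inj_on_def cyclic_diff_eq split: if_splits)
qed (use assms in auto)

lemma bij_betw_cyclic_diff_right:
  fixes d J :: nat
  assumes "J < d"
  shows "bij_betw (\<lambda>I. (J + d - I) mod d) {..<d} {..<d}"
proof (rule bij_betw_lessThan_if_inj)
  show "inj_on (\<lambda>I. (J + d - I) mod d) {..<d}"
    using assms by (auto simp: inj_on_def cyclic_diff_eq split: if_splits)
qed (use assms in auto)

text \<open>For a fixed block row \<open>I\<close>, the diagonal number takes each value below
  \<open>d\<close> exactly once as the block column varies, so \<open>I\<close> drops out. This
  serves both the fill counts and the entry sums.\<close>

lemma sum_block_row:
  fixes F :: "nat \<Rightarrow> nat \<Rightarrow> 'a::comm_monoid_add"
  assumes "I < d"
  shows "(\<Sum>j<d * g. F ((j div g + d - I) mod d) (j mod g)) = (\<Sum>b<g. \<Sum>s<d. F s b)"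
proof -
  have "(\<Sum>j<d * g. F ((j div g + d - I) mod d) (j mod g))
      = (\<Sum>J<d. \<Sum>b<g. F ((J + d - I) mod d) b)"
    by (rule sum_div_mod)
  also have "\<dots> = (\<Sum>s<d. \<Sum>b<g. F s b)"
    by (rule sum.reindex_bij_betw[OF bij_betw_cyclic_diff_left[OF assms], of "\<lambda>s. \<Sum>b<g. F s b"])
  finally show ?thesis by (simp add: sum.swap[of _ "{..<d}"])
qed

lemma sum_block_col:
  fixes F :: "nat \<Rightarrow> nat \<Rightarrow> 'a::comm_monoid_add"
  assumes "J < d"
  shows "(\<Sum>i<d * q. F ((J + d - i div q) mod d) (i mod q)) = (\<Sum>a<q. \<Sum>s<d. F s a)"
proof -
  have "(\<Sum>i<d * q. F ((J + d - i div q) mod d) (i mod q))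
      = (\<Sum>I<d. \<Sum>a<q. F ((J + d - I) mod d) a)"
    by (rule sum_div_mod)
  also have "\<dots> = (\<Sum>s<d. \<Sum>a<q. F s a)"
    by (rule sum.reindex_bij_betw[OF bij_betw_cyclic_diff_right[OF assms], of "\<lambda>s. \<Sum>a<q. F s a"])
  finally show ?thesis by (simp add: sum.swap[of _ "{..<d}"])
qed

section \<open>Values along the diagonals and sums modulo p\<close>

lemma sum_diagonal_indicator:
  assumes "e \<le> d"
  shows "(\<Sum>s<d. if s < e then 1 else 0 :: nat) = e"
proof -
  have "{..<d} \<inter> {s. s < e} = {..<e}" using assms by auto
  then show ?thesis by (simp add: sum.If_cases)
qed

text \<open>Since \<open>w \<le> e\<close>, every 2 lies on a filled diagonal, and each value splits
  as the indicator of \<open>s < e\<close> plus that of \<open>s < w\<close>.\<close>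

lemma sum_diagonal_values:
  assumes "e \<le> d" and "w \<le> e"
  shows "(\<Sum>s<d. if s < e then (if s < w then 2 else 1) else 0 :: int) = int (e + w)"
proof -
  have "(\<Sum>s<d. if s < e then (if s < w then 2 else 1) else 0 :: int)
      = (\<Sum>s<d. int (if s < e then 1 else 0) + int (if s < w then 1 else 0))"
    using assms by (intro sum.cong) auto
  also have "\<dots> = int (\<Sum>s<d. if s < e then 1 else 0) + int (\<Sum>s<d. if s < w then 1 else 0)"
    by (simp only: sum.distrib of_nat_sum)
  finally show ?thesis using assms by (simp only: sum_diagonal_indicator le_trans of_nat_add)
qed

lemma ordered_sum_integer_mod_group:
  "ordered_sum (integer_mod_group p) v
     = (\<Sum>i<dim_vec v. case v $ i of None \<Rightarrow> 0 | Some x \<Rightarrow> x) mod int p"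
proof -
  \<comment> \<open>Reduction can wait until the end, but \<open>z\<close> must already be reduced:
    on an empty list the fold returns \<open>z\<close> untouched.\<close>
  have fold: "foldl (\<lambda>x y. (x + y) mod int p) z xs = (z + sum_list xs) mod int p"
    if "z mod int p = z" for z :: int and xs
    using that
    by (induction xs arbitrary: z) (simp_all add: mod_add_left_eq add.assoc[symmetric])
  have filter: "sum_list (List.map_filter id xs)
      = sum_list (map (case_option 0 (\<lambda>x. x)) xs)" for xs :: "int option list"
    by (induction xs) (auto simp: List.map_filter_def split: option.splits)
  have "ordered_sum (integer_mod_group p) v = sum_list (entries v) mod int p"
    unfolding ordered_sum_def by (simp add: fold mult_integer_mod_group)
  also have "sum_list (entries v) = (\<Sum>i<dim_vec v. case v $ i of None \<Rightarrow> 0 | Some x \<Rightarrow> x)"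
    unfolding entries_def filter
    by (simp add: sum_list_sum_nth list_of_vec_index atLeast0LessThan)
  finally show ?thesis .
qed

section \<open>Cross-shaped weights modulo 3\<close>

text \<open>If \<open>e \<ge> 2\<close>, then \<open>r\<close> and \<open>t\<close> each avoid one residue, after which \<open>c \<in> {0, 1, 2}\<close> can avoid two.
  If \<open>e = 1\<close>, the bound \<open>c \<le> e\<close> leaves no such freedom and explicit values are needed.\<close>

lemma cross_weights_exist:
  fixes e g q :: nat
  assumes "0 < e" and "0 < g" and "0 < q"
  obtains r t c where "r \<le> e" and "t \<le> e" and "c \<le> e"
    and "\<not> 3 dvd e * g + r" and "\<not> 3 dvd e * q + t"
    and "\<not> 3 dvd e * g + (c + (g - 1) * t)" and "\<not> 3 dvd e * q + (c + (q - 1) * r)"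
proof (cases "e = 1")
  case True
  define r where "r = (if 3 dvd g then 1 else 0::nat)"
  define t where "t = (if 3 dvd q then 1 else 0::nat)"
  \<comment> \<open>The last two sums are g and q if r = t = 0; 2g - 1 and 2q - 1, both -1 modulo 3,
    if r = t = 1; g + 1 and 2q, with 3 dividing g but not q, if r = 1 and t = 0. The remaining case
    is symmetric.\<close>
  define c where "c = (if r = t then 0 else 1::nat)"
  have "\<not> 3 dvd g + (c + (g - 1) * t)" "\<not> 3 dvd q + (c + (q - 1) * r)"
    using assms unfolding c_def r_def t_def by (auto; presburger)+
  moreover have "\<not> 3 dvd g + r" "\<not> 3 dvd q + t" "r \<le> 1" "t \<le> 1" "c \<le> 1"
    by (auto simp: r_def t_def c_def) presburger+
  ultimately show ?thesis using that[of r t c] True by simp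
next
  case False
  have avoid: "\<exists>x\<le>1. \<not> 3 dvd u + x" for u :: nat
    by presburger
  have avoid2: "\<exists>x\<le>2. \<not> 3 dvd u + (x + y) \<and> \<not> 3 dvd v + (x + z)" for u v y z :: nat
  proof (rule ccontr)
    assume "\<not> ?thesis"
    then have *: "3 dvd u + (x + y) \<or> 3 dvd v + (x + z)" if "x \<le> 2" for x using that by blast
    show False using *[of 0] *[of 1] *[of 2] by simp presburger
  qed
  obtain r t where "r \<le> 1" "\<not> 3 dvd e * g + r" "t \<le> 1" "\<not> 3 dvd e * q + t"
    using avoid by meson
  moreover obtain c where "c \<le> 2" "\<not> 3 dvd e * g + (c + (g - 1) * t)"
      "\<not> 3 dvd e * q + (c + (q - 1) * r)"
    using avoid2 by blast
  ultimately show ?thesis using that[of r t c] assms(1) False by simp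
qed

lemma sum_cross_row:
  assumes "0 < (g::nat)"
  shows "(\<Sum>b<g. if b = 0 then x else y) = x + (g - 1) * (y::nat)"
  using assms by (cases g) (simp_all add: sum.lessThan_Suc_shift del: sum.lessThan_Suc)

section \<open>Signed entries and factorization of the parameters\<close>

lemma signed_entries_units:
  assumes "\<And>i j. (i, j) \<in> filled_cells A \<Longrightarrow> A $$ (i, j) \<in> {Some 1, Some 2}"
  shows "count (signed_entries (integer_mod_group 3) A) x
    = (if x \<in> carrier (integer_mod_group 3) - {\<one>\<^bsub>integer_mod_group 3\<^esub>}
       then card (filled_cells A) else 0)"
proof -
  have inv: "inv\<^bsub>integer_mod_group 3\<^esub> 1 = (2::int)" "inv\<^bsub>integer_mod_group 3\<^esub> 2 = (1::int)"
    by (simp_all add: inv_integer_mod_group carrier_integer_mod_group)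
  have "{#the (A $$ (i, j)), inv\<^bsub>integer_mod_group 3\<^esub> (the (A $$ (i, j)))#} = {#1, 2#}"
    if "(i, j) \<in> filled_cells A" for i j
    using assms[OF that] inv by auto
  then have "signed_entries (integer_mod_group 3) A = (\<Sum>_\<in>filled_cells A. {#1, 2#})"
    unfolding signed_entries_def by (intro sum.cong) auto
  then have "count (signed_entries (integer_mod_group 3) A) x
      = card (filled_cells A) * count {#1, 2#} x"
    by (simp add: count_sum)
  moreover have "count {#1, 2#} x = (if x \<in> {1, 2} then 1 else 0)" by auto
  moreover have "carrier (integer_mod_group 3) - {\<one>\<^bsub>integer_mod_group 3\<^esub>} = {1, 2}"
    by (auto simp: carrier_integer_mod_group)
  ultimately show ?thesis by simp
qed

text \<open>Cancelling \<open>g\<close> from \<open>n * k = m * h\<close> leaves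
  \<open>d * k = m * e\<close>. As \<open>e\<close> and \<open>d\<close> are coprime,
  \<open>e\<close> divides \<open>k\<close>, and cancelling \<open>e\<close> gives
  \<open>m = d * q\<close>.\<close>

lemma gcd_factorization:
  fixes m n h k :: nat
  assumes "0 < n" and "0 < h" and "h \<le> n" and "n * k = m * h"
  obtains d e g q where "m = d * q" and "n = d * g" and "h = e * g" and "k = e * q" and "e \<le> d"
proof -
  define g where "g = gcd h n"
  have "g > 0" using assms by (simp add: g_def)
  obtain e d where ed: "h = e * g" "n = d * g" "coprime e d"
    using gcd_coprime_exists[of h n] \<open>g > 0\<close> unfolding g_def by auto
  have dk: "d * k = m * e"
    using assms(4) \<open>g > 0\<close> by (simp add: ed mult.assoc mult.left_commute)
  then have "e dvd k"
    using ed(3) by (metis coprime_dvd_mult_right_iff dvd_triv_right)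
  then obtain q where q: "k = e * q" by blast
  have "e > 0" using assms(2) ed by auto
  then have "m = d * q" using dk q by (simp add: mult.left_commute mult.commute)
  moreover have "e \<le> d" using assms(3) ed \<open>g > 0\<close> by simp
  ultimately show ?thesis using that ed q by blast
qed

section \<open>The block array and its verification\<close>

lemma NH_3_block_array:
  fixes d e g q :: nat
  assumes "0 < d" and "0 < e" and "0 < g" and "0 < q" and "e \<le> d"
  shows "\<exists>A. NH (integer_mod_group 3) (d * g * (e * q)) (d * q) (d * g) (e * g) (e * q) A"
proof -
  obtain r t c where le: "r \<le> e" "t \<le> e" "c \<le> e"
    and ndvd: "\<not> 3 dvd e * g + r" "\<not> 3 dvd e * q + t"
      "\<not> 3 dvd e * g + (c + (g - 1) * t)" "\<not> 3 dvd e * q + (c + (q - 1) * r)"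
    using cross_weights_exist[OF assms(2-4)] by blast
  \<comment> \<open>Corner \<open>c\<close>, rest of the first row \<open>t\<close>, rest of the
    first column \<open>r\<close>: the row and column totals of \<open>w\<close> are then exactly
    the terms added in \<open>ndvd\<close>.\<close>
  define w where "w a b = (if a = 0 then if b = 0 then c else t else if b = 0 then r else 0)"
    for a b :: nat
  have w_le: "w a b \<le> e" for a b using le by (auto simp: w_def)
  \<comment> \<open>\<open>w a b\<close> is the same for all \<open>b \<ge> 1\<close>, so
    \<open>w a 1\<close> represents them; for \<open>g = 1\<close> its factor \<open>g - 1\<close>
    vanishes.\<close>
  have row_w: "\<not> 3 dvd (\<Sum>b<g. e + w a b)" for a
    using ndvd(1,3) sum_cross_row[OF assms(3), of "w a 0" "w a 1"]
    by (cases "a = 0") (auto simp: sum.distrib w_def mult.commute cong: if_cong)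
  have col_w: "\<not> 3 dvd (\<Sum>a<q. e + w a b)" for b
    using ndvd(2,4) sum_cross_row[OF assms(4), of "w 0 b" "w 1 b"]
    by (cases "b = 0") (auto simp: sum.distrib w_def mult.commute cong: if_cong)
  \<comment> \<open>The cyclic diagonal of the block containing cell (i, j).\<close>
  define s where "s i j = (j div g + d - i div q) mod d" for i j :: nat
  define A :: "int option mat" where
    "A = mat (d * q) (d * g) (\<lambda>(i, j). if s i j < e
       then Some (if s i j < w (i mod q) (j mod g) then 2 else 1) else None)"
  have dim: "dim_row A = d * q" "dim_col A = d * g" by (simp_all add: A_def)
  have A_index: "A $$ (i, j) = (if s i j < e
       then Some (if s i j < w (i mod q) (j mod g) then 2 else 1) else None)"
    if "i < d * q" "j < d * g" for i j using that by (simp add: A_def)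
  have filled: "(i, j) \<in> filled_cells A \<longleftrightarrow> i < d * q \<and> j < d * g \<and> s i j < e" for i j
    by (auto simp: filled_cells_def dim A_index split: if_splits)
  have div_less: "i div q < d" if "i < d * q" for i
    using that by (simp add: less_mult_imp_div_less)
  have div_less': "j div g < d" if "j < d * g" for j
    using that by (simp add: less_mult_imp_div_less)

  have row_card: "card {j. (i, j) \<in> filled_cells A} = e * g" if i: "i < d * q" for i
  proof -
    have "{j. (i, j) \<in> filled_cells A} = {j \<in> {..<d * g}. s i j < e}"
      using i by (auto simp: filled)
    then have "card {j. (i, j) \<in> filled_cells A} = (\<Sum>j<d * g. if s i j < e then 1 else 0)"
      by (simp add: sum.If_cases Int_def)
    also have "\<dots> = (\<Sum>b<g. \<Sum>s<d. if s < e then 1 else 0)"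
      unfolding s_def by (rule sum_block_row[OF div_less[OF i], of "\<lambda>s b. if s < e then 1 else 0"])
    finally show ?thesis using assms(5) by (simp only: sum_diagonal_indicator) simp
  qed
  have col_card: "card {i. (i, j) \<in> filled_cells A} = e * q" if j: "j < d * g" for j
  proof -
    have "{i. (i, j) \<in> filled_cells A} = {i \<in> {..<d * q}. s i j < e}"
      using j by (auto simp: filled)
    then have "card {i. (i, j) \<in> filled_cells A} = (\<Sum>i<d * q. if s i j < e then 1 else 0)"
      by (simp add: sum.If_cases Int_def)
    also have "\<dots> = (\<Sum>a<q. \<Sum>s<d. if s < e then 1 else 0)"
      unfolding s_def by (rule sum_block_col[OF div_less'[OF j], of "\<lambda>s a. if s < e then 1 else 0"])
    finally show ?thesis using assms(5) by (simp only: sum_diagonal_indicator) simp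
  qed
  have "filled_cells A = (SIGMA i:{..<d * q}. {j. (i, j) \<in> filled_cells A})"
    using filled by auto
  moreover have "finite {j. (i, j) \<in> filled_cells A}" for i
    by (rule finite_subset[of _ "{..<d * g}"]) (auto simp: filled)
  ultimately have "card (filled_cells A) = (\<Sum>i<d * q. card {j. (i, j) \<in> filled_cells A})"
    by (metis card_SigmaI finite_lessThan)
  then have card: "card (filled_cells A) = d * g * (e * q)"
    by (simp add: row_card)

  have row_sum: "ordered_sum (integer_mod_group 3) (row A i) \<noteq> \<one>\<^bsub>integer_mod_group 3\<^esub>"
    if i: "i < d * q" for i
  proof -
    \<comment> \<open>With the row fixed, an entry depends only on its diagonal and local column, as
      \<open>sum_block_row\<close> requires; the value 0 for \<open>s \<ge> e\<close> matches empty
      cells.\<close>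
    define F where "F s b = (if s < e then (if s < w (i mod q) b then 2 else 1) else 0 :: int)"
      for s b
    have "(\<Sum>j<d * g. case row A i $ j of None \<Rightarrow> 0 | Some x \<Rightarrow> x)
        = (\<Sum>j<d * g. F ((j div g + d - i div q) mod d) (j mod g))"
      using i by (intro sum.cong) (auto simp: A_index dim F_def s_def)
    also have "\<dots> = (\<Sum>b<g. \<Sum>s<d. F s b)"
      by (rule sum_block_row[OF div_less[OF i]])
    also have "\<dots> = int (\<Sum>b<g. e + w (i mod q) b)"
      unfolding F_def by (simp only: sum_diagonal_values[OF assms(5) w_le] of_nat_sum)
    finally have eq: "(\<Sum>j<d * g. case row A i $ j of None \<Rightarrow> 0 | Some x \<Rightarrow> x)
        = int (\<Sum>b<g. e + w (i mod q) b)" .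
    have "\<not> int 3 dvd int (\<Sum>b<g. e + w (i mod q) b)"
      using row_w by (simp only: int_dvd_int_iff) simp
    then show ?thesis
      by (simp only: ordered_sum_integer_mod_group index_row dim eq one_integer_mod_group
          dvd_eq_mod_eq_0) simp
  qed
  have col_sum: "ordered_sum (integer_mod_group 3) (col A j) \<noteq> \<one>\<^bsub>integer_mod_group 3\<^esub>"
    if j: "j < d * g" for j
  proof -
    define F where "F s a = (if s < e then (if s < w a (j mod g) then 2 else 1) else 0 :: int)"
      for s a
    have "(\<Sum>i<d * q. case col A j $ i of None \<Rightarrow> 0 | Some x \<Rightarrow> x)
        = (\<Sum>i<d * q. F ((j div g + d - i div q) mod d) (i mod q))"
      using j by (intro sum.cong) (auto simp: A_index dim F_def s_def)
    also have "\<dots> = (\<Sum>a<q. \<Sum>s<d. F s a)"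
      by (rule sum_block_col[OF div_less'[OF j]])
    also have "\<dots> = int (\<Sum>a<q. e + w a (j mod g))"
      unfolding F_def by (simp only: sum_diagonal_values[OF assms(5) w_le] of_nat_sum)
    finally have eq: "(\<Sum>i<d * q. case col A j $ i of None \<Rightarrow> 0 | Some x \<Rightarrow> x)
        = int (\<Sum>a<q. e + w a (j mod g))" .
    have "\<not> int 3 dvd int (\<Sum>a<q. e + w a (j mod g))"
      using col_w by (simp only: int_dvd_int_iff) simp
    then show ?thesis
      by (simp only: ordered_sum_integer_mod_group dim_col dim eq one_integer_mod_group
          dvd_eq_mod_eq_0) simp
  qed

  have "count (signed_entries (integer_mod_group 3) A) x
      = (if x \<in> carrier (integer_mod_group 3) - {\<one>\<^bsub>integer_mod_group 3\<^esub>}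
         then d * g * (e * q) else 0)" for x
    unfolding card[symmetric] by (rule signed_entries_units) (auto simp: filled A_index)
  moreover have "pf_array (integer_mod_group 3) (d * q) (d * g) A"
    unfolding pf_array_def
  proof (intro conjI allI impI)
    show "A \<in> carrier_mat (d * q) (d * g)" by (simp add: A_def)
    fix i j assume "i < d * q" "j < d * g"
    then show "set_option (A $$ (i, j)) \<subseteq> carrier (integer_mod_group 3)"
      by (simp add: A_index carrier_integer_mod_group)
  qed
  moreover have "subgroup {\<one>\<^bsub>integer_mod_group 3\<^esub>} (integer_mod_group 3)"
    by (rule group.triv_subgroup[OF group_integer_mod_group])
  ultimately have "NH (integer_mod_group 3) (d * g * (e * q)) (d * q) (d * g) (e * g) (e * q) A"
    unfolding relative_NH_def using row_card col_card row_sum col_sum by auto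
  then show ?thesis ..
qed

theorem theorem3p1:
  fixes lam m n h k :: nat
  assumes "lam > 0" and "m > 0" and "n > 0" and "h > 0" and "k > 0"
    and "h \<le> n" and "k \<le> m"
    and "n * k = m * h"
    and "(3::real) = 2 * real n * real k / real lam + 1"
  shows "\<exists>A. NH (integer_mod_group 3) lam m n h k A"
proof -
  \<comment> \<open>Subtracting 1 leaves 2 = 2nk/\<lambda>, and \<lambda> > 0 permits clearing the
    denominator.\<close>
  have "real lam = real (n * k)" using assms(1,9) by (simp add: field_simps)
  then have lam: "lam = n * k" by linarith
  obtain d e g q where f: "m = d * q" "n = d * g" "h = e * g" "k = e * q" "e \<le> d"
    by (rule gcd_factorization[OF assms(3,4,6,8)])
  have "0 < d" "0 < e" "0 < g" "0 < q"
    using assms(2-5) f(1-4) by (auto intro: gr0I)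
  from NH_3_block_array[OF this f(5)] show ?thesis
    unfolding lam f(1-4) .
qed

end
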